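(* Let $n\ge 2$ be an integer, $u\in H^1(0,1)$ and $h\in L^2(0,1)$. Then $$\big(\mathrm{Id}_m^{-1}(u'')\,\big|\,h\big)_{H^{-1}(T)}=-\int_0^1u\,\overline h\,dx+u(1)\overline{\mu_0(h)}+\big(nu(0)-n(n-1)\mu_{n-2}(u)\big)\overline{\mu_1(h)}+\big((1-n)u(0)-u(1)+n(n-1)\mu_{n-2}(u)\big)\overline{\mu_n(h)}.$$
   Context: Functions are complex-valued. $H^1(T):=\{u\in H^1(0,1):u(0)=u(1)\}$, $H^{-1}(T)$ is its (anti)dual with $L^2(0,1)$ as pivot (so $L^2(0,1)\subset H^{-1}(T)$), and $\mathcal D(T)$ is the set of $C^\infty$ functions on $[0,1]$ all of whose derivatives coincide at $0$ and $1$. For $k\in\mathbb N_0$ and $f\in L^1(0,1)$, $\mu_k(f):=\int_0^1(1-x)^kf(x)\,dx$; for $f\in H^{-1}(T)$, $\mu_0(f):=\langle f,1\rangle$. $\mathrm{Id}_m^{-1}f$, for $f\in H^{-1}(0,1)$, denotes the unique $w\in H^{-1}(T)$ with $\mu_0(w)=0$ whose restriction to $H^1_0(0,1)\subset H^1(T)$ equals $f$. For $\varphi\in\mathcal D(T)$ let $J_n\varphi(x):=\int_x^1\varphi\,dy-\mu_0(\varphi)(1-x)^n$ and for $w\in H^{-1}(T)$ let $P_nw$ be the distribution $\varphi\mapsto\langle w,J_n\varphi\rangle$ (it lies in $L^2(0,1)$). The inner product on $H^{-1}(T)$ used here is $(w|v)_{H^{-1}(T)}:=\int_0^1P_nw\,\overline{P_nv}\,dx+\mu_0(w)\overline{\mu_0(v)}$.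 *)

theory Defs
  imports "HOL-Analysis.Analysis"
begin

definition intv :: "real \<Rightarrow> real \<Rightarrow> (real \<Rightarrow> complex) \<Rightarrow> complex" where
  "intv a b f = integral\<^sup>L (lebesgue_on {a..b}) f"

definition L2 :: "(real \<Rightarrow> complex) \<Rightarrow> bool" where
  "L2 f \<longleftrightarrow> f \<in> borel_measurable (lebesgue_on {0..1}) \<and>
     integrable (lebesgue_on {0..1}) (\<lambda>x. (cmod (f x))\<^sup>2)"

definition weak_deriv :: "(real \<Rightarrow> complex) \<Rightarrow> (real \<Rightarrow> complex) \<Rightarrow> bool" where
  "weak_deriv u g \<longleftrightarrow> L2 g \<and> (\<forall>x\<in>{0..1}. u x = u 0 + intv 0 x g)"

definition H1 :: "(real \<Rightarrow> complex) \<Rightarrow> bool" where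
  "H1 u \<longleftrightarrow> (\<exists>g. weak_deriv u g)"

definition D1 :: "(real \<Rightarrow> complex) \<Rightarrow> (real \<Rightarrow> complex)" where
  "D1 u = (SOME g. weak_deriv u g)"

definition H1T :: "(real \<Rightarrow> complex) \<Rightarrow> bool" where
  "H1T u \<longleftrightarrow> H1 u \<and> u 0 = u 1"

definition H10 :: "(real \<Rightarrow> complex) \<Rightarrow> bool" where
  "H10 u \<longleftrightarrow> H1 u \<and> u 0 = 0 \<and> u 1 = 0"

definition H1norm :: "(real \<Rightarrow> complex) \<Rightarrow> real" where
  "H1norm u = sqrt (integral\<^sup>L (lebesgue_on {0..1}) (\<lambda>x. (cmod (u x))\<^sup>2)
                 + integral\<^sup>L (lebesgue_on {0..1}) (\<lambda>x. (cmod (D1 u x))\<^sup>2))"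

definition antidual :: "((real \<Rightarrow> complex) \<Rightarrow> bool) \<Rightarrow> (((real \<Rightarrow> complex) \<Rightarrow> complex) set)" where
  "antidual V = {w. (\<forall>\<phi> \<psi>. V \<phi> \<longrightarrow> V \<psi> \<longrightarrow> w (\<lambda>x. \<phi> x + \<psi> x) = w \<phi> + w \<psi>)
     \<and> (\<forall>c \<phi>. V \<phi> \<longrightarrow> w (\<lambda>x. c * \<phi> x) = cnj c * w \<phi>)
     \<and> (\<exists>C. \<forall>\<phi>. V \<phi> \<longrightarrow> cmod (w \<phi>) \<le> C * H1norm \<phi>)
     \<and> (\<forall>\<phi>. \<not> V \<phi> \<longrightarrow> w \<phi> = 0)}"

definition Hm1T :: "((real \<Rightarrow> complex) \<Rightarrow> complex) set" where
  "Hm1T = antidual H1T"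

definition Hm1 :: "((real \<Rightarrow> complex) \<Rightarrow> complex) set" where
  "Hm1 = antidual H10"

(* embedding of L^2(0,1) into H^{-1}(T) (pivot L^2) *)
definition embT :: "(real \<Rightarrow> complex) \<Rightarrow> ((real \<Rightarrow> complex) \<Rightarrow> complex)" where
  "embT f = (\<lambda>\<phi>. if H1T \<phi> then intv 0 1 (\<lambda>x. f x * cnj (\<phi> x)) else 0)"

definition dd :: "(real \<Rightarrow> complex) \<Rightarrow> ((real \<Rightarrow> complex) \<Rightarrow> complex)" where
  "dd u = (\<lambda>\<phi>. if H10 \<phi> then - intv 0 1 (\<lambda>x. D1 u x * cnj (D1 \<phi> x)) else 0)"

definition mu :: "nat \<Rightarrow> (real \<Rightarrow> complex) \<Rightarrow> complex" where
  "mu k f = intv 0 1 (\<lambda>x. complex_of_real ((1 - x) ^ k) * f x)"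

definition mu0T :: "((real \<Rightarrow> complex) \<Rightarrow> complex) \<Rightarrow> complex" where
  "mu0T w = w (\<lambda>_. 1)"

definition Idm_inv :: "((real \<Rightarrow> complex) \<Rightarrow> complex) \<Rightarrow> ((real \<Rightarrow> complex) \<Rightarrow> complex)" where
  "Idm_inv f = (THE w. w \<in> Hm1T \<and> mu0T w = 0 \<and> (\<forall>\<phi>. H10 \<phi> \<longrightarrow> w \<phi> = f \<phi>))"

definition DT :: "(real \<Rightarrow> complex) \<Rightarrow> bool" where
  "DT \<phi> \<longleftrightarrow> (\<exists>d :: nat \<Rightarrow> real \<Rightarrow> complex. d 0 = \<phi> \<and>
     (\<forall>k. \<forall>x\<in>{0..1}. (d k has_vector_derivative d (Suc k) x) (at x within {0..1})) \<and>
     (\<forall>k. d k 0 = d k 1))"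

definition Jn :: "nat \<Rightarrow> (real \<Rightarrow> complex) \<Rightarrow> (real \<Rightarrow> complex)" where
  "Jn n \<phi> = (\<lambda>x. intv x 1 \<phi> - mu 0 \<phi> * complex_of_real ((1 - x) ^ n))"

definition Pn :: "nat \<Rightarrow> ((real \<Rightarrow> complex) \<Rightarrow> complex) \<Rightarrow> (real \<Rightarrow> complex)" where
  "Pn n w = (SOME f. L2 f \<and> (\<forall>\<phi>. DT \<phi> \<longrightarrow> intv 0 1 (\<lambda>x. f x * cnj (\<phi> x)) = w (Jn n \<phi>)))"

definition innerT :: "nat \<Rightarrow> ((real \<Rightarrow> complex) \<Rightarrow> complex) \<Rightarrow> ((real \<Rightarrow> complex) \<Rightarrow> complex) \<Rightarrow> complex" where
  "innerT n w v = intv 0 1 (\<lambda>x. Pn n w x * cnj (Pn n v x)) + mu0T w * cnj (mu0T v)"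

end

theory Submission
  imports Defs
begin

text \<open>
  \<open>Id_m^{-1}(u'')\<close> is the functional \<open>\<phi> \<mapsto> - \<integral> u' \<phi>'\<close> (with a conjugate on \<open>\<phi>'\<close>) on all of \<open>H^1(T)\<close>:
  it annihilates constants, and \<open>H^1(T)\<close> is the sum of \<open>H^1_0\<close> and the constants. Testing with
  \<open>J_n \<phi>\<close> gives \<open>P_n (Id_m^{-1}(u'')) = u' - n \<mu>_{n-1}(u') = u' + n u(0) - n (n-1) \<mu>_{n-2}(u)\<close>, and
  \<open>P_n h = H - \<mu>_n(h)\<close> with \<open>H(x) = \<integral>_0^x h\<close>. The formula is then one integration by parts in
  \<open>\<integral> u' H\<close>.

  Weak derivatives and \<open>P_n\<close> are only determined almost everywhere. Both uniqueness statements reduce to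
  the vanishing of a function whose integrals over all \<open>[0, b]\<close> vanish; for test functions in \<open>D(T)\<close>
  this uses trigonometric polynomials that approximate the indicator of \<open>(0, b)\<close>.
\<close>

section \<open>Functions on the unit interval with vanishing integrals over all initial
  intervals\<close>

lemma finite_measure_unit: "finite_measure (lebesgue_on {0..1::real})"
  by (rule finite_measure_lebesgue_on) simp

text \<open>Turns integrals over varying subintervals into integrals of cut-off functions over the
  one finite measure space \<open>lebesgue_on {0..1}\<close>, where Fubini and almost-everywhere
  arguments take place.\<close>

lemma intv_unit_eq_lebesgue:
  assumes "0 \<le> a" "b \<le> 1"
  shows "intv a b f = (\<integral>x. indicator {a..b} x *\<^sub>R f x \<partial>lebesgue_on {0..1})"
proof -
  have "(\<integral>x. indicator {a..b} x *\<^sub>R f x \<partial>lebesgue_on {0..1})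
      = (\<integral>x. indicator {0..1} x *\<^sub>R indicator {a..b} x *\<^sub>R f x \<partial>lebesgue)"
    by (rule integral_restrict_space) simp
  also have "\<dots> = (\<integral>x. indicator {a..b} x *\<^sub>R f x \<partial>lebesgue)"
    using assms by (intro Bochner_Integration.integral_cong) (auto simp: indicator_def)
  also have "\<dots> = intv a b f"
    unfolding intv_def by (rule integral_restrict_space[symmetric]) simp
  finally show ?thesis ..
qed

text \<open>The rays \<open>{..b}\<close> are stable under intersection and generate the Borel sets,
  so a Dynkin argument carries the vanishing from rays to all Borel sets. Null sets carry it on to
  Lebesgue sets, and a density with zero integral over every measurable set is zero almost
  everywhere.\<close>

lemma AE_zero_of_intv_zero:
  assumes g: "integrable (lebesgue_on {0..1}) g"
    and zero: "\<And>b. b \<in> {0..1} \<Longrightarrow> intv 0 b g = 0"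
  shows "AE x in lebesgue_on {0..1}. g x = 0"
proof -
  \<comment> \<open>Extension by zero, so that rays of the whole line can replace the intervals
    \<open>{0..b}\<close>.\<close>
  define G where "G = (\<lambda>x. indicator {0..1::real} x *\<^sub>R g x)"
  have G: "integrable lebesgue G"
    using g unfolding G_def by (subst integrable_restrict_space[symmetric]) auto
  have G_atMost: "set_lebesgue_integral lebesgue {..b} G = 0" for b
  proof -
    consider "b < 0" | "b \<in> {0..1}" | "b > 1" by fastforce
    then show ?thesis
    proof cases
      case 1
      then have "(\<lambda>x. indicator {..b} x *\<^sub>R G x) = (\<lambda>x. 0)"
        by (auto simp: G_def indicator_def fun_eq_iff)
      then show ?thesis by (simp add: set_lebesgue_integral_def)
    next
      case 2
      then have "set_lebesgue_integral lebesgue {..b} G = (\<integral>x. indicator {0..b} x *\<^sub>R g x \<partial>lebesgue)"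
        unfolding set_lebesgue_integral_def G_def
        by (intro Bochner_Integration.integral_cong) (auto simp: indicator_def)
      also have "\<dots> = intv 0 b g"
        unfolding intv_def by (rule integral_restrict_space[symmetric]) simp
      finally show ?thesis using zero[OF 2] by simp
    next
      case 3
      then have "set_lebesgue_integral lebesgue {..b} G = (\<integral>x. indicator {0..1} x *\<^sub>R g x \<partial>lebesgue)"
        unfolding set_lebesgue_integral_def G_def
        by (intro Bochner_Integration.integral_cong) (auto simp: indicator_def)
      also have "\<dots> = intv 0 1 g"
        unfolding intv_def by (rule integral_restrict_space[symmetric]) simp
      finally show ?thesis using zero[of 1] by simp
    qed
  qed
  \<comment> \<open>Serves the complement case of the induction below, where complements are taken
    in the whole line.\<close>
  have G_UNIV: "integral\<^sup>L lebesgue G = 0"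
  proof -
    have "integral\<^sup>L lebesgue G = set_lebesgue_integral lebesgue {..1} G"
      unfolding set_lebesgue_integral_def G_def
      by (intro Bochner_Integration.integral_cong) (auto simp: indicator_def)
    then show ?thesis using G_atMost by simp
  qed
  have borel: "set_lebesgue_integral lebesgue A G = 0" if "A \<in> sets borel" for A
  proof -
    have sigma: "A \<in> sigma_sets UNIV (range (atMost :: real \<Rightarrow> _))"
      using that by (subst (asm) borel_eq_atMost) simp
    have stable: "Int_stable (range (atMost :: real \<Rightarrow> _))"
      by (auto simp: Int_stable_def intro!: image_eqI[of _ _ "min _ _"])
    show ?thesis
      using stable subset_UNIV[of "range (atMost :: real \<Rightarrow> _)", folded Pow_UNIV] sigma
    proof (induction rule: sigma_sets_induct_disjoint)
      case (compl A)
      then have "A \<in> sets borel" by (subst borel_eq_atMost) simp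
      then have A: "A \<in> sets lebesgue" by simp
      have "set_lebesgue_integral lebesgue (UNIV - A) G = integral\<^sup>L lebesgue (\<lambda>x. G x - indicator A x *\<^sub>R G x)"
        unfolding set_lebesgue_integral_def
        by (intro Bochner_Integration.integral_cong) (auto simp: indicator_def)
      also have "\<dots> = integral\<^sup>L lebesgue G - set_lebesgue_integral lebesgue A G"
        unfolding set_lebesgue_integral_def using G A
        by (intro Bochner_Integration.integral_diff integrable_mult_indicator) auto
      finally show ?case using compl G_UNIV by simp
    next
      case (union A)
      then have "\<And>i. A i \<in> sets borel" by (subst borel_eq_atMost) auto
      then have A: "\<And>i. A i \<in> sets lebesgue" by simp
      have "set_lebesgue_integral lebesgue (\<Union>i. A i) G = (\<Sum>i. set_lebesgue_integral lebesgue (A i) G)"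
        using union(1) A G
        by (intro lebesgue_integral_countable_add)
          (auto simp: disjoint_family_on_def set_integrable_def intro!: integrable_mult_indicator)
      then show ?case using union by simp
    qed (use G_atMost in \<open>auto simp: set_lebesgue_integral_def\<close>)
  qed
  have "set_lebesgue_integral lebesgue A G = 0" if A: "A \<in> sets lebesgue" for A
  proof -
    \<comment> \<open>A Lebesgue set differs from its Borel main part only by a null set.\<close>
    have "AE x in lborel. x \<in> main_part lborel A \<longleftrightarrow> x \<in> A" by (rule AE_in_main_part[OF A])
    then have "AE x in lebesgue. x \<in> main_part lborel A \<longleftrightarrow> x \<in> A" by (rule AE_completion)
    then have "set_lebesgue_integral lebesgue A G = set_lebesgue_integral lebesgue (main_part lborel A) G"
      unfolding set_lebesgue_integral_def using A G
      by (intro integral_cong_AE borel_measurable_scaleR borel_measurable_indicator) (auto simp: indicator_def)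
    moreover have "main_part lborel A \<in> sets borel" using A by (metis main_part_sets sets_lborel)
    ultimately show ?thesis using borel by simp
  qed
  note lebesgue = this
  interpret finite_measure "lebesgue_on {0..1::real}"
    by (rule finite_measure_unit)
  show ?thesis
  proof (rule density_zero[OF g])
    fix A assume "A \<in> sets (lebesgue_on {0..1::real})"
    then have A: "A \<in> sets lebesgue" by (auto simp: sets_restrict_space)
    have "set_lebesgue_integral (lebesgue_on {0..1}) A g
        = (\<integral>x. indicator {0..1} x *\<^sub>R indicator A x *\<^sub>R g x \<partial>lebesgue)"
      unfolding set_lebesgue_integral_def by (rule integral_restrict_space) simp
    also have "\<dots> = set_lebesgue_integral lebesgue A G"
      unfolding set_lebesgue_integral_def G_def by (simp add: mult.commute)
    finally show "set_lebesgue_integral (lebesgue_on {0..1}) A g = 0"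
      using lebesgue[OF A] by simp
  qed
qed

section \<open>Square-integrable functions on the unit interval\<close>

lemma L2_imp_integrable:
  assumes "L2 f"
  shows "integrable (lebesgue_on {0..1}) f"
proof (rule Bochner_Integration.integrable_bound)
  show "integrable (lebesgue_on {0..1}) (\<lambda>x. 1 + (cmod (f x))\<^sup>2)"
    using assms by (auto simp: L2_def)
  have "cmod z \<le> 1 + (cmod z)\<^sup>2" for z
    using zero_le_power2[of "cmod z - 1"] norm_ge_zero[of z] unfolding power2_diff power_one by linarith
  then show "AE x in lebesgue_on {0..1}. norm (f x) \<le> norm (1 + (cmod (f x))\<^sup>2)"
    by simp
qed (use assms in \<open>auto simp: L2_def\<close>)

lemma L2_mult_integrable:
  assumes "L2 f" "L2 g"
  shows "integrable (lebesgue_on {0..1}) (\<lambda>x. f x * cnj (g x))"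
proof (rule Bochner_Integration.integrable_bound)
  show "integrable (lebesgue_on {0..1}) (\<lambda>x. (cmod (f x))\<^sup>2 + (cmod (g x))\<^sup>2)"
    using assms by (auto simp: L2_def)
  have "a * b \<le> a\<^sup>2 + b\<^sup>2" if "a \<ge> 0" "b \<ge> 0" for a b :: real
    using zero_le_power2[of "a - b"] mult_nonneg_nonneg[OF that] unfolding power2_diff by simp
  then show "AE x in lebesgue_on {0..1}. norm (f x * cnj (g x)) \<le> norm ((cmod (f x))\<^sup>2 + (cmod (g x))\<^sup>2)"
    by (simp add: norm_mult)
  have [measurable]: "f \<in> borel_measurable (lebesgue_on {0..1})" "g \<in> borel_measurable (lebesgue_on {0..1})"
    using assms by (auto simp: L2_def)
  have "(\<lambda>x. cnj (g x)) \<in> borel_measurable (lebesgue_on {0..1})"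
    by (rule borel_measurable_continuous_on[OF continuous_on_cnj]) (auto intro: continuous_intros)
  then show "(\<lambda>x. f x * cnj (g x)) \<in> borel_measurable (lebesgue_on {0..1})"
    by measurable
qed

lemma L2_continuous:
  assumes "continuous_on {0..1} f"
  shows "L2 f"
  using assms unfolding L2_def
  by (auto intro!: continuous_imp_measurable_on_sets_lebesgue continuous_imp_integrable_real continuous_intros)

lemma L2_add:
  assumes "L2 f" "L2 g"
  shows "L2 (\<lambda>x. f x + g x)"
proof -
  have [measurable]: "f \<in> borel_measurable (lebesgue_on {0..1})" "g \<in> borel_measurable (lebesgue_on {0..1})"
    using assms by (auto simp: L2_def)
  have "(cmod (w + z))\<^sup>2 \<le> 2 * (cmod w)\<^sup>2 + 2 * (cmod z)\<^sup>2" for w z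
  proof -
    have "(cmod (w + z))\<^sup>2 \<le> (cmod w + cmod z)\<^sup>2" by (intro power_mono norm_triangle_ineq) simp
    then show ?thesis using zero_le_power2[of "cmod w - cmod z"] unfolding power2_diff power2_sum by simp
  qed
  note bound = this
  have "integrable (lebesgue_on {0..1}) (\<lambda>x. (cmod (f x + g x))\<^sup>2)"
  proof (rule Bochner_Integration.integrable_bound)
    show "integrable (lebesgue_on {0..1}) (\<lambda>x. 2 * (cmod (f x))\<^sup>2 + 2 * (cmod (g x))\<^sup>2)"
      using assms unfolding L2_def by (intro Bochner_Integration.integrable_add integrable_mult_right) auto
    show "AE x in lebesgue_on {0..1}. norm ((cmod (f x + g x))\<^sup>2) \<le> norm (2 * (cmod (f x))\<^sup>2 + 2 * (cmod (g x))\<^sup>2)"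
      using bound by simp
  qed measurable
  then show ?thesis unfolding L2_def by simp
qed

lemma L2_cmult:
  assumes "L2 f"
  shows "L2 (\<lambda>x. c * f x)"
proof -
  have [measurable]: "f \<in> borel_measurable (lebesgue_on {0..1})"
    using assms by (auto simp: L2_def)
  have "integrable (lebesgue_on {0..1}) (\<lambda>x. (cmod c)\<^sup>2 * (cmod (f x))\<^sup>2)"
    using assms unfolding L2_def by (intro integrable_mult_right) auto
  then show ?thesis unfolding L2_def by (simp add: norm_mult power_mult_distrib)
qed

lemma L2_const: "L2 (\<lambda>x. c)"
  by (rule L2_continuous) (rule continuous_on_const)

text \<open>The constant is far from the Cauchy-Schwarz one, but any bound that is homogeneous in \<open>g\<close> suffices
  for membership in the antidual.\<close>
lemma L2_functional_bound:
  assumes f: "L2 f"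
  shows "\<exists>C\<ge>0. \<forall>g. L2 g \<longrightarrow> cmod (intv 0 1 (\<lambda>x. f x * cnj (g x))) \<le> C * sqrt (\<integral>x. (cmod (g x))\<^sup>2 \<partial>lebesgue_on {0..1})"
proof -
  define M where "M = lebesgue_on {0..1::real}"
  define A where "A = (\<integral>x. (cmod (f x))\<^sup>2 \<partial>M)"
  have A0: "A \<ge> 0" unfolding A_def by simp
  have "cmod (intv 0 1 (\<lambda>x. f x * cnj (g x))) \<le> ((A + 1) / 2) * sqrt (\<integral>x. (cmod (g x))\<^sup>2 \<partial>M)" if g: "L2 g" for g
  proof -
    define B where "B = (\<integral>x. (cmod (g x))\<^sup>2 \<partial>M)"
    have B0: "B \<ge> 0" unfolding B_def by simp
    have intf: "integrable M (\<lambda>x. (cmod (f x))\<^sup>2)" and intg: "integrable M (\<lambda>x. (cmod (g x))\<^sup>2)"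
      and gm: "g \<in> borel_measurable M"
      using f g by (auto simp: L2_def M_def)
    show ?thesis
    proof (cases "B = 0")
      \<comment> \<open>Treated apart because the weight \<open>1 / (2 * t)\<close> below needs
        \<open>B\<close> nonzero; here \<open>g\<close> vanishes almost everywhere.\<close>
      case True
      then have "AE x in M. (cmod (g x))\<^sup>2 = 0"
        using intg unfolding B_def by (subst (asm) integral_nonneg_eq_0_iff_AE) auto
      then have "AE x in M. f x * cnj (g x) = 0" by eventually_elim simp
      then have "intv 0 1 (\<lambda>x. f x * cnj (g x)) = 0"
        unfolding intv_def M_def by (rule integral_eq_zero_AE)
      then show ?thesis using A0 B0 by (simp add: B_def)
    next
      case False
      \<comment> \<open>With this weight in Young's inequality, \<open>B / (2 * t)\<close> becomes
        \<open>t / 2\<close>, so both terms are proportional to the norm of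
        \<open>g\<close>.\<close>
      define t where "t = sqrt B"
      have t: "t > 0" "t * t = B" using False B0 by (auto simp: t_def)
      have "cmod (intv 0 1 (\<lambda>x. f x * cnj (g x))) \<le> (\<integral>x. (t / 2) * (cmod (f x))\<^sup>2 + (1 / (2 * t)) * (cmod (g x))\<^sup>2 \<partial>M)"
        unfolding intv_def M_def[symmetric]
      proof (rule order_trans[OF integral_norm_bound integral_mono])
        show "integrable M (\<lambda>x. norm (f x * cnj (g x)))" using integrable_norm[OF L2_mult_integrable[OF f g]] by (simp add: M_def)
        show "integrable M (\<lambda>x. t / 2 * (cmod (f x))\<^sup>2 + 1 / (2 * t) * (cmod (g x))\<^sup>2)"
          using intf intg by simp
        fix x
        have "0 \<le> (t * cmod (f x) - cmod (g x))\<^sup>2 / (2 * t)" using t by simp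
        also have "\<dots> = t / 2 * (cmod (f x))\<^sup>2 + 1 / (2 * t) * (cmod (g x))\<^sup>2 - cmod (f x) * cmod (g x)"
          using t by (simp add: power2_eq_square field_simps)
        finally show "norm (f x * cnj (g x)) \<le> t / 2 * (cmod (f x))\<^sup>2 + 1 / (2 * t) * (cmod (g x))\<^sup>2"
          by (simp add: norm_mult)
      qed
      also have "\<dots> = (t / 2) * A + (1 / (2 * t)) * B"
        using intf intg by (simp add: A_def B_def)
      also have "\<dots> = ((A + 1) / 2) * t"
        using t by (simp add: t(2)[symmetric] field_simps)
      finally show ?thesis by (simp add: t_def B_def)
    qed
  qed
  then show ?thesis using A0 unfolding M_def by (intro exI[of _ "(A + 1) / 2"]) auto
qed

section \<open>Rules for integrals over intervals, and Fubini on the unit square\<close>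

lemma id_measurable_unit [measurable]: "(\<lambda>x. x) \<in> borel_measurable (lebesgue_on {0..1::real})"
  using id_borel_measurable_lebesgue_on by (simp add: id_def)

lemma AE_unit_neq: "AE x in lebesgue_on {0..1::real}. x \<noteq> a"
proof -
  have "AE x in lebesgue. x \<noteq> a" by (intro AE_completion AE_lborel_singleton)
  then have "AE x in lebesgue. x \<in> {0..1} \<longrightarrow> x \<noteq> a" by eventually_elim simp
  then show ?thesis by (subst AE_restrict_space_iff) auto
qed

lemma integrable_mult_continuous:
  fixes f G :: "real \<Rightarrow> complex"
  assumes f: "integrable (lebesgue_on {0..1}) f" and G: "continuous_on {0..1} G"
  shows "integrable (lebesgue_on {0..1}) (\<lambda>x. f x * G x)"
proof -
  obtain B where B: "\<And>x. x \<in> {0..1} \<Longrightarrow> cmod (G x) \<le> B"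
    using compact_imp_bounded[OF compact_continuous_image[OF G compact_Icc]]
    unfolding bounded_iff by blast
  have B0: "B \<ge> 0" using B[of 0] order_trans[OF norm_ge_zero] by auto
  have [measurable]: "f \<in> borel_measurable (lebesgue_on {0..1})" using f by simp
  have [measurable]: "G \<in> borel_measurable (lebesgue_on {0..1})"
    using G by (intro continuous_imp_measurable_on_sets_lebesgue) auto
  show ?thesis
  proof (rule Bochner_Integration.integrable_bound)
    show "integrable (lebesgue_on {0..1}) (\<lambda>x. of_real B * f x)" using f by (intro integrable_mult_right)
    show "AE x in lebesgue_on {0..1}. norm (f x * G x) \<le> norm (of_real B * f x)"
      using B B0 by (intro AE_I2) (auto simp: norm_mult mult.commute[of "cmod (f _)"] intro!: mult_right_mono)
  qed measurable
qed

lemma intv_cnj: "intv a b (\<lambda>x. cnj (f x)) = cnj (intv a b f)"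
  by (simp add: intv_def)

lemma intv_add:
  assumes "integrable (lebesgue_on {a..b}) f" "integrable (lebesgue_on {a..b}) g"
  shows "intv a b (\<lambda>x. f x + g x) = intv a b f + intv a b g"
  using assms by (simp add: intv_def)

lemma intv_cmult: "intv a b (\<lambda>x. c * f x) = c * intv a b f"
  by (simp add: intv_def)

lemma intv_cong:
  assumes "\<And>x. x \<in> {a..b} \<Longrightarrow> f x = g x"
  shows "intv a b f = intv a b g"
  unfolding intv_def using assms by (intro Bochner_Integration.integral_cong) auto

lemma intv_cong_AE:
  assumes "integrable (lebesgue_on {a..b}) f" "integrable (lebesgue_on {a..b}) g"
    and "AE x in lebesgue_on {a..b}. f x = g x"
  shows "intv a b f = intv a b g"
  unfolding intv_def using assms by (intro integral_cong_AE) auto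

text \<open>Splitting the unit square along its diagonal.\<close>
lemma intv_mult_intv:
  assumes f: "integrable (lebesgue_on {0..1}) f" and g: "integrable (lebesgue_on {0..1}) g"
  shows "intv 0 1 (\<lambda>x. f x * intv 0 x g) + intv 0 1 (\<lambda>x. g x * intv 0 x f) = intv 0 1 f * intv 0 1 g"
proof -
  define M where "M = lebesgue_on {0..1::real}"
  interpret M: finite_measure M unfolding M_def by (rule finite_measure_unit)
  interpret P: pair_sigma_finite M M ..
  note [measurable] = id_measurable_unit[folded M_def]
  have [measurable]: "f \<in> borel_measurable M" "g \<in> borel_measurable M" using f g by (auto simp: M_def)
  have fM: "integrable M f" and gM: "integrable M g" using f g by (auto simp: M_def)
  have K: "integrable (M \<Otimes>\<^sub>M M) (\<lambda>(x, y). f x * g y)"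
  proof (rule P.Fubini_integrable)
    show "integrable M (\<lambda>x. LINT y|M. norm (case (x, y) of (x, y) \<Rightarrow> f x * g y))"
      using fM by (simp add: norm_mult)
    show "AE x in M. integrable M (\<lambda>y. case (x, y) of (x, y) \<Rightarrow> f x * g y)"
      using gM by simp
  qed measurable
  \<comment> \<open>The integrable kernel dominates each of its restrictions to a measurable region;
    used for both closed triangles and for the diagonal.\<close>
  have part: "integrable (M \<Otimes>\<^sub>M M) (\<lambda>(x, y). if Q x y then f x * g y else 0)"
    if [measurable]: "Measurable.pred (M \<Otimes>\<^sub>M M) (\<lambda>(x, y). Q x y)" for Q
  proof (rule Bochner_Integration.integrable_bound[OF K])
    have "(\<lambda>p. if (\<lambda>(x, y). Q x y) p then (\<lambda>(x, y). f x * g y) p else 0) \<in> borel_measurable (M \<Otimes>\<^sub>M M)"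
      by measurable
    then show "(\<lambda>(x, y). if Q x y then f x * g y else 0) \<in> borel_measurable (M \<Otimes>\<^sub>M M)"
      by (simp add: case_prod_beta')
  qed auto
  have le: "integrable (M \<Otimes>\<^sub>M M) (\<lambda>(x, y). if y \<le> x then f x * g y else 0)"
    by (rule part) measurable
  have ge: "integrable (M \<Otimes>\<^sub>M M) (\<lambda>(x, y). if x \<le> y then f x * g y else 0)"
    by (rule part) measurable
  have eq: "integrable (M \<Otimes>\<^sub>M M) (\<lambda>(x, y). if x = y then f x * g y else 0)"
    by (rule part) measurable
  have "intv 0 1 (\<lambda>x. f x * intv 0 x g) = (\<integral>x. (\<integral>y. (if y \<le> x then f x * g y else 0) \<partial>M) \<partial>M)"
    unfolding intv_def[of 0 1] M_def[symmetric]
  proof (rule Bochner_Integration.integral_cong[OF refl])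
    fix x assume "x \<in> space M"
    then have x: "0 \<le> x" "x \<le> 1" by (auto simp: M_def)
    have "f x * intv 0 x g = (\<integral>y. f x * (indicator {0..x} y *\<^sub>R g y) \<partial>M)"
      unfolding intv_unit_eq_lebesgue[OF order_refl x(2)] M_def[symmetric]
      by (rule integral_mult_right_zero[symmetric])
    also have "\<dots> = (\<integral>y. (if y \<le> x then f x * g y else 0) \<partial>M)"
      by (intro Bochner_Integration.integral_cong) (auto simp: M_def)
    finally show "f x * intv 0 x g = (\<integral>y. (if y \<le> x then f x * g y else 0) \<partial>M)" .
  qed
  also have "\<dots> = integral\<^sup>L (M \<Otimes>\<^sub>M M) (\<lambda>(x, y). if y \<le> x then f x * g y else 0)"
    by (rule P.integral_fst[OF le])
  finally have 1: "intv 0 1 (\<lambda>x. f x * intv 0 x g) = \<dots>" .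
  have "intv 0 1 (\<lambda>y. g y * intv 0 y f) = (\<integral>y. (\<integral>x. (if x \<le> y then f x * g y else 0) \<partial>M) \<partial>M)"
    unfolding intv_def[of 0 1] M_def[symmetric]
  proof (rule Bochner_Integration.integral_cong[OF refl])
    fix y assume "y \<in> space M"
    then have y: "0 \<le> y" "y \<le> 1" by (auto simp: M_def)
    have "g y * intv 0 y f = (\<integral>x. g y * (indicator {0..y} x *\<^sub>R f x) \<partial>M)"
      unfolding intv_unit_eq_lebesgue[OF order_refl y(2)] M_def[symmetric]
      by (rule integral_mult_right_zero[symmetric])
    also have "\<dots> = (\<integral>x. (if x \<le> y then f x * g y else 0) \<partial>M)"
      by (intro Bochner_Integration.integral_cong) (auto simp: M_def)
    finally show "g y * intv 0 y f = (\<integral>x. (if x \<le> y then f x * g y else 0) \<partial>M)" .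
  qed
  also have "\<dots> = integral\<^sup>L (M \<Otimes>\<^sub>M M) (\<lambda>(x, y). if x \<le> y then f x * g y else 0)"
    by (rule P.integral_snd[OF ge])
  finally have 2: "intv 0 1 (\<lambda>y. g y * intv 0 y f) = \<dots>" .
  \<comment> \<open>Every section of the diagonal is a single point, so the diagonal contributes
    nothing to the double integral.\<close>
  have "(\<integral>y. (if x = y then f x * g y else 0) \<partial>M) = 0" for x
  proof (rule integral_eq_zero_AE)
    show "AE y in M. (if x = y then f x * g y else 0) = 0"
      unfolding M_def using AE_unit_neq[of x] by eventually_elim auto
  qed
  then have "integral\<^sup>L (M \<Otimes>\<^sub>M M) (\<lambda>(x, y). if x = y then f x * g y else 0) = 0"
    using P.integral_fst[OF eq] by simp
  moreover have "integral\<^sup>L (M \<Otimes>\<^sub>M M) (\<lambda>(x, y). f x * g y) = intv 0 1 f * intv 0 1 g"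
    using P.integral_fst[OF K] by (simp add: intv_def M_def)
  \<comment> \<open>The two closed triangles cover the square, and the diagonal twice.\<close>
  moreover have "integral\<^sup>L (M \<Otimes>\<^sub>M M) (\<lambda>(x, y). if y \<le> x then f x * g y else 0)
      + integral\<^sup>L (M \<Otimes>\<^sub>M M) (\<lambda>(x, y). if x \<le> y then f x * g y else 0)
      = integral\<^sup>L (M \<Otimes>\<^sub>M M) (\<lambda>(x, y). f x * g y)
      + integral\<^sup>L (M \<Otimes>\<^sub>M M) (\<lambda>(x, y). if x = y then f x * g y else 0)"
    unfolding Bochner_Integration.integral_add[OF le ge, symmetric]
      Bochner_Integration.integral_add[OF K eq, symmetric]
    by (intro Bochner_Integration.integral_cong) auto
  ultimately show ?thesis unfolding 1 2 by simp
qed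

section \<open>Primitives of integrable functions and integration by parts\<close>

text \<open>Absolute continuity of \<open>F\<close> on the unit interval with a merely integrable
  density \<open>f\<close>; weak derivatives are the densities that are also square integrable. Test
  functions, powers, \<open>u\<close> and the indefinite integral of \<open>h\<close> are all
  handled through this one notion.\<close>

definition primitive :: "(real \<Rightarrow> complex) \<Rightarrow> (real \<Rightarrow> complex) \<Rightarrow> bool" where
  "primitive F f \<longleftrightarrow> integrable (lebesgue_on {0..1}) f \<and> (\<forall>x\<in>{0..1}. intv 0 x f = F x - F 0)"

lemma weak_deriv_iff_primitive: "weak_deriv u g \<longleftrightarrow> L2 g \<and> primitive u g"
  using L2_imp_integrable by (auto simp: weak_deriv_def primitive_def eq_diff_eq add.commute eq_commute)

lemma continuous_intv:
  assumes "integrable (lebesgue_on {0..1}) f"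
  shows "continuous_on {0..1} (\<lambda>x. intv 0 x f)"
  unfolding intv_def using assms by (rule indefinite_integral_continuous_real)

lemma primitive_continuous:
  assumes "primitive F f"
  shows "continuous_on {0..1} F"
proof -
  have "continuous_on {0..1} (\<lambda>x. F 0 + intv 0 x f)"
    using assms by (intro continuous_intros continuous_intv) (simp add: primitive_def)
  then show ?thesis
    by (rule continuous_on_eq) (use assms in \<open>auto simp: primitive_def\<close>)
qed

lemma intv_0_0 [simp]: "intv 0 0 f = 0"
proof -
  have "AE x in lebesgue_on {0..1}. indicator {0..0} x *\<^sub>R f x = 0"
    using AE_unit_neq[of 0] by eventually_elim auto
  then show ?thesis
    unfolding intv_unit_eq_lebesgue[OF order_refl zero_le_one] by (rule integral_eq_zero_AE)
qed

lemma primitive_intv: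
  assumes "integrable (lebesgue_on {0..1}) f"
  shows "primitive (\<lambda>x. intv 0 x f) f"
  using assms by (simp add: primitive_def)

lemma primitive_cnj:
  assumes "primitive F f"
  shows "primitive (\<lambda>x. cnj (F x)) (\<lambda>x. cnj (f x))"
  using assms by (auto simp: primitive_def intv_cnj)

lemma primitive_lincomb:
  assumes "primitive F f" "primitive G g"
  shows "primitive (\<lambda>x. a * F x + b * G x) (\<lambda>x. a * f x + b * g x)"
proof -
  have f: "integrable (lebesgue_on {0..1}) f" and g: "integrable (lebesgue_on {0..1}) g"
    using assms by (auto simp: primitive_def)
  have "intv 0 x (\<lambda>x. a * f x + b * g x) = a * intv 0 x f + b * intv 0 x g" if "x \<in> {0..1}" for x
    using that integrable_subinterval[OF f, of 0 x] integrable_subinterval[OF g, of 0 x]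
    by (subst intv_add) (auto simp: intv_cmult)
  then show ?thesis
    using assms by (auto simp: primitive_def right_diff_distrib)
qed

lemma primitive_deriv:
  assumes deriv: "\<And>x. x \<in> {0..1} \<Longrightarrow> (F has_vector_derivative f x) (at x within {0..1})"
    and cont: "continuous_on {0..1} f"
  shows "primitive F f"
proof -
  have f: "integrable (lebesgue_on {0..1}) f" using cont by (rule continuous_imp_integrable_real)
  have "intv 0 x f = F x - F 0" if x: "x \<in> {0..1}" for x
  proof -
    have "(f has_integral F x - F 0) {0..x}"
    proof (rule fundamental_theorem_of_calculus)
      fix y assume "y \<in> {0..x}"
      with x show "(F has_vector_derivative f y) (at y within {0..x})"
        by (intro has_vector_derivative_within_subset[OF deriv]) auto
    qed (use x in simp)
    moreover have "intv 0 x f = integral {0..x} f"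
      unfolding intv_def using x by (intro lebesgue_integral_eq_integral integrable_subinterval[OF f]) auto
    ultimately show ?thesis by (simp add: integral_unique)
  qed
  then show ?thesis using f by (auto simp: primitive_def)
qed

text \<open>The difference of the two densities is a density of the zero function, so its integrals
  over all initial intervals vanish. This makes the arbitrary choice in \<open>D1\<close>
  harmless.\<close>

lemma primitive_unique_AE:
  assumes "primitive F f" "primitive F g"
  shows "AE x in lebesgue_on {0..1}. f x = g x"
proof -
  have "primitive (\<lambda>x. 1 * F x + (- 1) * F x) (\<lambda>x. 1 * f x + (- 1) * g x)"
    by (rule primitive_lincomb[OF assms])
  then have "AE x in lebesgue_on {0..1}. 1 * f x + (- 1) * g x = 0"
    by (intro AE_zero_of_intv_zero) (auto simp: primitive_def)
  then show ?thesis by simp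
qed

text \<open>Substituting \<open>F x = F 0 + intv 0 x f\<close>, and likewise for \<open>G\<close>,
  turns the two integrals into multiples of \<open>intv 0 1 f\<close> and \<open>intv 0 1 g\<close>
  plus the two triangle integrals of \<open>intv_mult_intv\<close>.\<close>

lemma primitive_by_parts:
  assumes F: "primitive F f" and G: "primitive G g"
  shows "intv 0 1 (\<lambda>x. f x * G x) + intv 0 1 (\<lambda>x. F x * g x) = F 1 * G 1 - F 0 * G 0"
proof -
  have f: "integrable (lebesgue_on {0..1}) f" and g: "integrable (lebesgue_on {0..1}) g"
    using assms by (auto simp: primitive_def)
  have "intv 0 1 (\<lambda>x. f x * G x) = intv 0 1 (\<lambda>x. G 0 * f x + f x * intv 0 x g)"
    using G by (intro intv_cong) (auto simp: primitive_def right_diff_distrib mult.commute)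
  also have "\<dots> = G 0 * intv 0 1 f + intv 0 1 (\<lambda>x. f x * intv 0 x g)"
    by (subst intv_add) (simp_all add: intv_cmult f integrable_mult_continuous[OF f continuous_intv[OF g]])
  finally have 1: "intv 0 1 (\<lambda>x. f x * G x) = \<dots>" .
  have "intv 0 1 (\<lambda>x. F x * g x) = intv 0 1 (\<lambda>x. F 0 * g x + g x * intv 0 x f)"
    using F by (intro intv_cong) (auto simp: primitive_def right_diff_distrib mult.commute)
  also have "\<dots> = F 0 * intv 0 1 g + intv 0 1 (\<lambda>x. g x * intv 0 x f)"
    by (subst intv_add) (simp_all add: intv_cmult g integrable_mult_continuous[OF g continuous_intv[OF f]])
  finally have 2: "intv 0 1 (\<lambda>x. F x * g x) = \<dots>" .
  have FG: "intv 0 1 f = F 1 - F 0" "intv 0 1 g = G 1 - G 0"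
    using F G by (auto simp: primitive_def)
  show ?thesis
    unfolding 1 2 using intv_mult_intv[OF f g] unfolding FG by algebra
qed

section \<open>Trigonometric test functions and orthogonality to all of \<open>DT\<close>\<close>

lemma DT_cis: "DT (\<lambda>x. cis (2 * pi * real_of_int j * x))"
proof -
  define c where "c = \<i> * complex_of_real (2 * pi * real_of_int j)"
  \<comment> \<open>All derivatives of the exponential at once, as \<open>DT\<close> asks for the
    whole sequence.\<close>
  define d where "d = (\<lambda>(k::nat) x::real. c ^ k * exp (c * of_real x))"
  have "(d k has_vector_derivative d (Suc k) x) (at x within {0..1})" for k x
    unfolding d_def
    by (rule has_vector_derivative_real_field) (auto intro!: derivative_eq_intros)
  moreover have d0: "d 0 = (\<lambda>x. cis (2 * pi * real_of_int j * x))"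
    by (simp add: d_def c_def cis_conv_exp mult_ac)
  moreover have "d k 0 = d k 1" for k
    using cis_multiple_2pi[of "real_of_int j"] by (simp add: d_def c_def cis_conv_exp mult_ac)
  ultimately show ?thesis
    unfolding DT_def by (intro exI[of _ d]) auto
qed

lemma DT_continuous:
  assumes "DT \<phi>"
  shows "continuous_on {0..1} \<phi>"
proof -
  obtain d where "d 0 = \<phi>" "\<And>k x. x \<in> {0..1} \<Longrightarrow> (d k has_vector_derivative d (Suc k) x) (at x within {0..1})"
    using assms unfolding DT_def by blast
  then have "\<And>x. x \<in> {0..1} \<Longrightarrow> (\<phi> has_vector_derivative d (Suc 0) x) (at x within {0..1})" by metis
  then show ?thesis
    unfolding continuous_on_eq_continuous_within by (blast intro: has_vector_derivative_continuous)
qed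

text \<open>The phase puts both ends \<open>0\<close> and \<open>b\<close> on the level
  \<open>cos (pi * b)\<close>. The difference of the cosines factors as
  \<open>2 * sin (pi * x) * sin (pi * (b - x))\<close>; the first sine is nonnegative on the unit
  interval and vanishes only at its ends, and in between the second has the sign of
  \<open>b - x\<close>.\<close>

lemma cos_gt_cos_iff_in_interval:
  assumes x: "x \<in> {0..1}" and b: "b \<in> {0..1}"
  shows "cos (2 * pi * x - pi * b) > cos (pi * b) \<longleftrightarrow> 0 < x \<and> x < b"
proof -
  have eq: "cos (2 * pi * x - pi * b) - cos (pi * b) = 2 * sin (pi * x) * sin (pi * (b - x))"
    unfolding cos_diff_cos by (simp add: algebra_simps diff_divide_distrib add_divide_distrib)
  have pos: "sin (pi * t) > 0" if "0 < t" "t < 1" for t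
    using that by (intro sin_gt_zero) auto
  have "sin (pi * x) \<ge> 0" using x by (intro sin_ge_zero) auto
  show ?thesis
  proof
    assume "cos (2 * pi * x - pi * b) > cos (pi * b)"
    then have prod: "sin (pi * x) * sin (pi * (b - x)) > 0" using eq by simp
    then have "sin (pi * x) \<noteq> 0" "sin (pi * (b - x)) > 0"
      using \<open>sin (pi * x) \<ge> 0\<close> by (auto simp: zero_less_mult_iff)
    moreover have "sin (pi * (b - x)) \<le> 0" if "x \<ge> b"
    proof -
      have "sin (pi * (x - b)) \<ge> 0" using that x b by (intro sin_ge_zero) auto
      moreover have "sin (pi * (b - x)) = - sin (pi * (x - b))"
        by (metis minus_diff_eq mult_minus_right sin_minus)
      ultimately show ?thesis by simp
    qed
    ultimately show "0 < x \<and> x < b" using x by (cases "x = 0") force+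
  next
    assume "0 < x \<and> x < b"
    then have "sin (pi * x) * sin (pi * (b - x)) > 0" using b by (intro mult_pos_pos pos) auto
    then show "cos (2 * pi * x - pi * b) > cos (pi * b)" using eq by simp
  qed
qed

text \<open>By Euler's formula, a factor of the shifted cosine moves the frequency \<open>j\<close>
  by one in either direction; hence the induction on \<open>k\<close> keeps \<open>j\<close>
  arbitrary.\<close>

lemma intv_mult_cos_power_eq_0:
  assumes g: "integrable (lebesgue_on {0..1}) g"
    and orth: "\<And>j. intv 0 1 (\<lambda>x. g x * cis (2 * pi * real_of_int j * x)) = 0"
  shows "intv 0 1 (\<lambda>x. g x * (of_real (cos (2 * pi * x - s)) ^ k * cis (2 * pi * real_of_int j * x))) = 0"
proof (induction k arbitrary: j)
  case 0
  show ?case using orth by simp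
next
  case (Suc k)
  let ?I = "\<lambda>j x. g x * (of_real (cos (2 * pi * x - s)) ^ k * cis (2 * pi * real_of_int j * x))"
  have int: "integrable (lebesgue_on {0..1}) (?I j)" for j
    using g by (intro integrable_mult_continuous) (auto intro!: continuous_intros)
  have cos: "complex_of_real (cos t) = (cis t + cis (- t)) / 2" for t
    by (simp add: complex_eq_iff)
  have "g x * (of_real (cos (2 * pi * x - s)) ^ Suc k * cis (2 * pi * real_of_int j * x))
      = (cis (- s) / 2) * ?I (j + 1) x + (cis s / 2) * ?I (j - 1) x" for x
  proof -
    have "of_real (cos (2 * pi * x - s)) * cis (2 * pi * real_of_int j * x)
        = (cis (- s) / 2) * cis (2 * pi * real_of_int (j + 1) * x) + (cis s / 2) * cis (2 * pi * real_of_int (j - 1) * x)"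
      unfolding cos by (simp add: cis_mult algebra_simps)
    \<comment> \<open>Stated for arbitrary complex numbers, so that the factors stay opaque and only
      the relation for \<open>C * E\<close> is used.\<close>
    moreover have "G * (C * P * E) = A * (G * (P * E1)) + B * (G * (P * E2))"
      if "C * E = A * E1 + B * E2" for G C P E A B E1 E2 :: complex
    proof -
      have "G * (C * P * E) = G * P * (C * E)" by (simp add: mult_ac)
      then show ?thesis unfolding that by (simp add: algebra_simps)
    qed
    ultimately show ?thesis unfolding power_Suc by blast
  qed
  then have "intv 0 1 (\<lambda>x. g x * (of_real (cos (2 * pi * x - s)) ^ Suc k * cis (2 * pi * real_of_int j * x)))
      = (cis (- s) / 2) * intv 0 1 (?I (j + 1)) + (cis s / 2) * intv 0 1 (?I (j - 1))"
    by (simp only: intv_add integrable_mult_right int intv_cmult)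
  then show ?case unfolding Suc.IH by simp
qed

text \<open>Ramps of slope \<open>k\<close> rising from \<open>a\<close> and cut off at 1 converge
  pointwise to the step, and the Weierstrass theorem puts a polynomial within
  \<open>inverse (real (Suc k))\<close> of the \<open>k\<close>-th ramp on \<open>{-1..1}\<close>,
  which contains all values of the cosine. The uniform bound 2 is there for dominated
  convergence.\<close>

lemma polynomial_approx_step_function:
  fixes a :: real
  shows "\<exists>p. (\<forall>k. real_polynomial_function (p k)) \<and>
    (\<forall>t\<in>{-1..1}. (\<forall>k. \<bar>p k t\<bar> \<le> 2) \<and> (\<lambda>k. p k t) \<longlonglongrightarrow> of_bool (t > a))"
proof -
  define \<phi> where "\<phi> = (\<lambda>(k::nat) t. max 0 (min 1 (real k * (t - a))))"
  have "\<exists>q. real_polynomial_function q \<and> (\<forall>t\<in>{-1..1}. \<bar>\<phi> k t - q t\<bar> < inverse (real (Suc k)))" for k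
  proof -
    have cont: "continuous_on {-1..1} (\<phi> k)" unfolding \<phi>_def by (intro continuous_intros)
    show ?thesis
      by (rule Stone_Weierstrass_real_polynomial_function[OF compact_Icc cont, of "inverse (real (Suc k))"]) auto
  qed
  then obtain p where p: "\<And>k. real_polynomial_function (p k)"
    and close: "\<And>k t. t \<in> {-1..1} \<Longrightarrow> \<bar>\<phi> k t - p k t\<bar> < inverse (real (Suc k))"
    by metis
  show ?thesis
  proof (intro exI[of _ p] conjI allI ballI p)
    fix k t assume t: "t \<in> {-1..1::real}"
    have "inverse (real (Suc k)) \<le> 1" by (simp add: field_simps)
    moreover have "0 \<le> \<phi> k t" "\<phi> k t \<le> 1" by (auto simp: \<phi>_def)
    ultimately show "\<bar>p k t\<bar> \<le> 2" using close[OF t, of k] by linarith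
  next
    fix t assume t: "t \<in> {-1..1::real}"
    have "(\<lambda>k. \<phi> k t) \<longlonglongrightarrow> of_bool (t > a)"
    proof (cases "t > a")
      case True
      obtain N :: nat where N: "real N * (t - a) > 1" using True reals_Archimedean3[of "t - a"] by auto
      have "\<phi> k t = 1" if "k \<ge> N" for k
      proof -
        have "real N * (t - a) \<le> real k * (t - a)" using that True by (intro mult_right_mono) auto
        then show ?thesis using N by (simp add: \<phi>_def)
      qed
      then have "eventually (\<lambda>k. \<phi> k t = 1) sequentially" unfolding eventually_sequentially by blast
      then show ?thesis using True by (simp add: tendsto_eventually)
    next
      case False
      then have "real k * (t - a) \<le> 0" for k by (intro mult_nonneg_nonpos) auto
      then have "\<phi> k t = 0" for k unfolding \<phi>_def by (metis max.absorb1 min.coboundedI2)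
      then show ?thesis using False by simp
    qed
    moreover have "(\<lambda>k. \<phi> k t - p k t) \<longlonglongrightarrow> 0"
      by (rule Lim_null_comparison[OF _ LIMSEQ_inverse_real_of_nat])
        (use close[OF t] in \<open>auto intro!: always_eventually less_imp_le\<close>)
    ultimately show "(\<lambda>k. p k t) \<longlonglongrightarrow> of_bool (t > a)"
      using tendsto_diff[of "\<lambda>k. \<phi> k t" _ _ "\<lambda>k. \<phi> k t - p k t" 0] by fastforce
  qed
qed

text \<open>The interval \<open>(0, b)\<close> is a superlevel set of a shifted cosine, so its indicator is a bounded pointwise
  limit of polynomials in that cosine.\<close>
lemma AE_zero_of_orthogonal_DT:
  assumes g: "integrable (lebesgue_on {0..1}) g"
    and orth: "\<And>\<phi>. DT \<phi> \<Longrightarrow> intv 0 1 (\<lambda>x. g x * cnj (\<phi> x)) = 0"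
  shows "AE x in lebesgue_on {0..1}. g x = 0"
proof (rule AE_zero_of_intv_zero[OF g])
  fix b :: real assume b: "b \<in> {0..1}"
  \<comment> \<open>The pairing conjugates the test function, so frequency \<open>j\<close> is
    reached by testing with \<open>- j\<close>.\<close>
  have cis: "intv 0 1 (\<lambda>x. g x * cis (2 * pi * real_of_int j * x)) = 0" for j
    using orth[OF DT_cis[of "- j"]] by (simp add: cis_cnj)
  have cos_power: "intv 0 1 (\<lambda>x. g x * of_real (cos (2 * pi * x - pi * b)) ^ k) = 0" for k
    using intv_mult_cos_power_eq_0[OF g cis, where s = "pi * b" and k = k and j = 0] by simp
  define c where "c = (\<lambda>x. cos (2 * pi * x - pi * b))"
  have c: "c x \<in> {-1..1}" for x by (simp add: c_def)
  have cont_c: "continuous_on {0..1} c" unfolding c_def by (intro continuous_intros)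
  obtain p where p: "\<And>k. real_polynomial_function (p k)"
    and bound: "\<And>k t. t \<in> {-1..1} \<Longrightarrow> \<bar>p k t\<bar> \<le> 2"
    and lim: "\<And>t. t \<in> {-1..1} \<Longrightarrow> (\<lambda>k. p k t) \<longlonglongrightarrow> of_bool (t > cos (pi * b))"
    using polynomial_approx_step_function[of "cos (pi * b)"] by blast
  have int: "integrable (lebesgue_on {0..1}) (\<lambda>x. g x * of_real (p k (c x)))" for k
    using g continuous_on_polymonial_function[of "p k" UNIV] p[of k] real_polynomial_function_eq
    by (intro integrable_mult_continuous continuous_intros continuous_on_compose2[OF _ cont_c, of UNIV]) auto
  have zero: "intv 0 1 (\<lambda>x. g x * of_real (p k (c x))) = 0" for k
  proof -
    obtain a N where q: "p k = (\<lambda>t. \<Sum>i\<le>N. a i * t ^ i)"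
      using p[of k] unfolding real_polynomial_function_iff_sum by blast
    have "intv 0 1 (\<lambda>x. g x * of_real (p k (c x))) = intv 0 1 (\<lambda>x. \<Sum>i\<le>N. of_real (a i) * (g x * of_real (c x) ^ i))"
      by (rule intv_cong) (simp add: q sum_distrib_left mult_ac)
    also have "\<dots> = (\<Sum>i\<le>N. intv 0 1 (\<lambda>x. of_real (a i) * (g x * of_real (c x) ^ i)))"
      unfolding intv_def using g cont_c
      by (intro Bochner_Integration.integral_sum integrable_mult_right integrable_mult_continuous continuous_intros)
    also have "\<dots> = 0"
      using cos_power by (simp add: intv_cmult c_def)
    finally show ?thesis .
  qed
  have gm: "g \<in> borel_measurable (lebesgue_on {0..1})" using g by simp
  have "(\<lambda>k. intv 0 1 (\<lambda>x. g x * of_real (p k (c x)))) \<longlonglongrightarrow> intv 0 1 (\<lambda>x. g x * of_real (of_bool (c x > cos (pi * b))))"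
    unfolding intv_def
  proof (rule integral_dominated_convergence)
    show "integrable (lebesgue_on {0..1}) (\<lambda>x. 2 * norm (g x))"
      using g by (intro integrable_mult_right integrable_norm)
    show "AE x in lebesgue_on {0..1}. (\<lambda>k. g x * of_real (p k (c x))) \<longlonglongrightarrow> g x * of_real (of_bool (c x > cos (pi * b)))"
      using lim[OF c] by (intro AE_I2 tendsto_intros)
    show "AE x in lebesgue_on {0..1}. norm (g x * of_real (p k (c x))) \<le> 2 * norm (g x)" for k
      using bound[OF c] by (intro AE_I2) (auto simp: norm_mult mult.commute[of _ "cmod (g _)"] intro!: mult_left_mono)
    show "(\<lambda>x. g x * of_real (p k (c x))) \<in> borel_measurable (lebesgue_on {0..1})" for k
      using int by simp
    have [measurable]: "c \<in> borel_measurable (lebesgue_on {0..1})"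
      using cont_c by (intro continuous_imp_measurable_on_sets_lebesgue) auto
    note gm [measurable]
    show "(\<lambda>x. g x * of_real (of_bool (c x > cos (pi * b)))) \<in> borel_measurable (lebesgue_on {0..1})"
      by measurable
  qed
  then have "intv 0 1 (\<lambda>x. g x * of_real (of_bool (c x > cos (pi * b)))) = 0"
    using zero LIMSEQ_unique[OF tendsto_const] by fastforce
  moreover have "intv 0 b g = intv 0 1 (\<lambda>x. g x * of_real (of_bool (c x > cos (pi * b))))"
  proof -
    have [measurable]: "c \<in> borel_measurable (lebesgue_on {0..1})"
      using cont_c by (intro continuous_imp_measurable_on_sets_lebesgue) auto
    note gm [measurable]
    \<comment> \<open>Within the unit interval, \<open>{0..b}\<close> and the superlevel set differ
      at most in the points \<open>0\<close> and \<open>b\<close>.\<close>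
    have ae: "AE x in lebesgue_on {0..1}. indicator {0..b} x *\<^sub>R g x = g x * of_real (of_bool (c x > cos (pi * b)))"
      using AE_space AE_unit_neq[of 0] AE_unit_neq[of b]
    proof eventually_elim
      case (elim x)
      then show ?case
        using cos_gt_cos_iff_in_interval[of x b] b by (auto simp: c_def indicator_def)
    qed
    have "intv 0 b g = (\<integral>x. indicator {0..b} x *\<^sub>R g x \<partial>lebesgue_on {0..1})"
      using b by (intro intv_unit_eq_lebesgue) auto
    also have "\<dots> = intv 0 1 (\<lambda>x. g x * of_real (of_bool (c x > cos (pi * b))))"
      unfolding intv_def by (rule integral_cong_AE[OF _ _ ae]) measurable
    finally show ?thesis .
  qed
  ultimately show "intv 0 b g = 0" by simp
qed

section \<open>Weak derivatives and the functional \<open>Idm_inv (dd u)\<close>\<close>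

lemma weak_deriv_D1: "H1 u \<Longrightarrow> weak_deriv u (D1 u)"
  using someI_ex[of "weak_deriv u"] by (simp add: H1_def D1_def)

lemma L2_D1: "H1 u \<Longrightarrow> L2 (D1 u)"
  using weak_deriv_D1 by (simp add: weak_deriv_iff_primitive)

lemma primitive_D1: "H1 u \<Longrightarrow> primitive u (D1 u)"
  using weak_deriv_D1 by (simp add: weak_deriv_iff_primitive)

lemma weak_deriv_imp_H1: "weak_deriv u g \<Longrightarrow> H1 u"
  by (auto simp: H1_def)

lemma weak_deriv_lincomb:
  assumes "weak_deriv u f" "weak_deriv v g"
  shows "weak_deriv (\<lambda>x. a * u x + b * v x) (\<lambda>x. a * f x + b * g x)"
  using assms by (simp add: weak_deriv_iff_primitive primitive_lincomb L2_add L2_cmult)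

lemma weak_deriv_const: "weak_deriv (\<lambda>x. c) (\<lambda>x. 0)"
  by (simp add: weak_deriv_iff_primitive primitive_def intv_def L2_const)

text \<open>\<open>D1 \<phi>\<close> is an unspecified choice among weak derivatives that agree
  almost everywhere; this lets an explicit \<open>d\<close> replace it under the integral.\<close>

lemma intv_mult_cnj_D1:
  assumes g: "L2 g" and \<phi>: "weak_deriv \<phi> d"
  shows "intv 0 1 (\<lambda>x. g x * cnj (D1 \<phi> x)) = intv 0 1 (\<lambda>x. g x * cnj (d x))"
proof (rule intv_cong_AE)
  have D: "weak_deriv \<phi> (D1 \<phi>)" using \<phi> by (intro weak_deriv_D1 weak_deriv_imp_H1)
  show "integrable (lebesgue_on {0..1}) (\<lambda>x. g x * cnj (D1 \<phi> x))"
    "integrable (lebesgue_on {0..1}) (\<lambda>x. g x * cnj (d x))"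
    using g \<phi> D by (simp_all add: L2_mult_integrable weak_deriv_iff_primitive)
  have "AE x in lebesgue_on {0..1}. D1 \<phi> x = d x"
    using \<phi> D by (intro primitive_unique_AE) (auto simp: weak_deriv_iff_primitive)
  then show "AE x in lebesgue_on {0..1}. g x * cnj (D1 \<phi> x) = g x * cnj (d x)"
    by eventually_elim simp
qed

lemma intv_mult_cnj_lincomb:
  assumes "L2 g" "L2 d" "L2 e"
  shows "intv 0 1 (\<lambda>x. g x * cnj (a * d x + b * e x))
    = cnj a * intv 0 1 (\<lambda>x. g x * cnj (d x)) + cnj b * intv 0 1 (\<lambda>x. g x * cnj (e x))"
proof -
  have "intv 0 1 (\<lambda>x. g x * cnj (a * d x + b * e x))
      = intv 0 1 (\<lambda>x. cnj a * (g x * cnj (d x)) + cnj b * (g x * cnj (e x)))"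
    by (intro intv_cong) (simp add: algebra_simps)
  also have "\<dots> = cnj a * intv 0 1 (\<lambda>x. g x * cnj (d x)) + cnj b * intv 0 1 (\<lambda>x. g x * cnj (e x))"
    using assms by (subst intv_add) (simp_all add: intv_cmult L2_mult_integrable)
  finally show ?thesis .
qed

lemma H1T_lincomb:
  assumes "H1T \<phi>" "H1T \<psi>"
  shows "H1T (\<lambda>x. a * \<phi> x + b * \<psi> x)"
  using assms unfolding H1T_def H1_def by (auto intro: weak_deriv_lincomb)

text \<open>The distributional derivative of \<open>g\<close> on the torus; for \<open>g = u'\<close> it is \<open>Id_m^{-1}(u'')\<close>.\<close>
definition div_functional :: "(real \<Rightarrow> complex) \<Rightarrow> (real \<Rightarrow> complex) \<Rightarrow> complex" where
  "div_functional g \<phi> = (if H1T \<phi> then - intv 0 1 (\<lambda>x. g x * cnj (D1 \<phi> x)) else 0)"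

lemma div_functional_eq:
  assumes "L2 g" "weak_deriv \<phi> d" "\<phi> 0 = \<phi> 1"
  shows "div_functional g \<phi> = - intv 0 1 (\<lambda>x. g x * cnj (d x))"
  using assms by (auto simp: div_functional_def H1T_def intv_mult_cnj_D1 intro: weak_deriv_imp_H1)

text \<open>The choice \<open>D1\<close> need not be linear in its argument, but the combination of
  the chosen derivatives is an admissible weak derivative, which \<open>div_functional_eq\<close>
  accepts.\<close>

lemma div_functional_lincomb:
  assumes g: "L2 g" and \<phi>: "H1T \<phi>" and \<psi>: "H1T \<psi>"
  shows "div_functional g (\<lambda>x. a * \<phi> x + b * \<psi> x) = cnj a * div_functional g \<phi> + cnj b * div_functional g \<psi>"
proof -
  have "H1 \<phi>" "H1 \<psi>" "\<phi> 0 = \<phi> 1" "\<psi> 0 = \<psi> 1" using \<phi> \<psi> by (auto simp: H1T_def)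
  then have "div_functional g (\<lambda>x. a * \<phi> x + b * \<psi> x) = - intv 0 1 (\<lambda>x. g x * cnj (a * D1 \<phi> x + b * D1 \<psi> x))"
    by (intro div_functional_eq g weak_deriv_lincomb weak_deriv_D1) auto
  also have "\<dots> = cnj a * div_functional g \<phi> + cnj b * div_functional g \<psi>"
    using \<open>H1 \<phi>\<close> \<open>H1 \<psi>\<close> \<phi> \<psi> g by (subst intv_mult_cnj_lincomb) (auto simp: div_functional_def L2_D1)
  finally show ?thesis .
qed

text \<open>The bound is \<open>L2_functional_bound\<close> applied to \<open>D1 \<phi>\<close>,
  whose squared norm is one of the two summands under the root in \<open>H1norm\<close>.\<close>

lemma div_functional_in_Hm1T:
  assumes g: "L2 g"
  shows "div_functional g \<in> Hm1T"
proof -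
  obtain C where C: "C \<ge> 0"
    "\<And>d. L2 d \<Longrightarrow> cmod (intv 0 1 (\<lambda>x. g x * cnj (d x))) \<le> C * sqrt (\<integral>x. (cmod (d x))\<^sup>2 \<partial>lebesgue_on {0..1})"
    using L2_functional_bound[OF g] by blast
  have bound: "cmod (div_functional g \<phi>) \<le> C * H1norm \<phi>" if "H1T \<phi>" for \<phi>
  proof -
    have "cmod (div_functional g \<phi>) \<le> C * sqrt (\<integral>x. (cmod (D1 \<phi> x))\<^sup>2 \<partial>lebesgue_on {0..1})"
      using that C(2)[OF L2_D1, of \<phi>] by (simp add: div_functional_def H1T_def)
    also have "\<dots> \<le> C * H1norm \<phi>"
      unfolding H1norm_def using C(1) by (intro mult_left_mono real_sqrt_le_mono) auto
    finally show ?thesis .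
  qed
  show ?thesis
    unfolding Hm1T_def antidual_def
  proof (intro CollectI conjI allI impI)
    fix \<phi> \<psi> assume "H1T \<phi>" "H1T \<psi>"
    then show "div_functional g (\<lambda>x. \<phi> x + \<psi> x) = div_functional g \<phi> + div_functional g \<psi>"
      using div_functional_lincomb[OF g, of \<phi> \<psi> 1 1] by simp
  next
    fix c \<phi> assume "H1T \<phi>"
    then show "div_functional g (\<lambda>x. c * \<phi> x) = cnj c * div_functional g \<phi>"
      using div_functional_lincomb[OF g, of \<phi> \<phi> c 0] by simp
  next
    show "\<exists>C. \<forall>\<phi>. H1T \<phi> \<longrightarrow> cmod (div_functional g \<phi>) \<le> C * H1norm \<phi>"
      using bound by blast
  qed (simp add: div_functional_def)
qed

lemma mu0T_div_functional:
  assumes "L2 g"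
  shows "mu0T (div_functional g) = 0"
  using div_functional_eq[OF assms weak_deriv_const] by (simp add: mu0T_def intv_def)

lemma Idm_inv_dd:
  assumes u: "H1 u"
  shows "Idm_inv (dd u) = div_functional (D1 u)"
  unfolding Idm_inv_def
proof (rule the_equality)
  note g = L2_D1[OF u]
  show "div_functional (D1 u) \<in> Hm1T \<and> mu0T (div_functional (D1 u)) = 0 \<and>
      (\<forall>\<phi>. H10 \<phi> \<longrightarrow> div_functional (D1 u) \<phi> = dd u \<phi>)"
    using div_functional_in_Hm1T[OF g] mu0T_div_functional[OF g]
    by (simp add: div_functional_def dd_def H1T_def H10_def)
  fix w assume w: "w \<in> Hm1T \<and> mu0T w = 0 \<and> (\<forall>\<phi>. H10 \<phi> \<longrightarrow> w \<phi> = dd u \<phi>)"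
  have w_add: "w (\<lambda>x. \<phi> x + \<psi> x) = w \<phi> + w \<psi>" if "H1T \<phi>" "H1T \<psi>" for \<phi> \<psi>
    using w that by (auto simp: Hm1T_def antidual_def)
  have w_mult: "w (\<lambda>x. c * \<phi> x) = cnj c * w \<phi>" if "H1T \<phi>" for \<phi> c
    using w that by (auto simp: Hm1T_def antidual_def)
  have one: "H1T (\<lambda>_. 1)"
    using weak_deriv_const by (auto simp: H1T_def intro: weak_deriv_imp_H1)
  show "w = div_functional (D1 u)"
  proof
    fix \<phi>
    show "w \<phi> = div_functional (D1 u) \<phi>"
    proof (cases "H1T \<phi>")
      \<comment> \<open>Off \<open>H1T\<close> both functionals take the default value 0 fixed in
        \<open>antidual\<close>, so they agree as total functions.\<close>
      case False
      then show ?thesis using w by (auto simp: Hm1T_def antidual_def div_functional_def)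
    next
      case True
      \<comment> \<open>Subtracting the value at \<open>0\<close> gives an element of
        \<open>H10\<close>, where \<open>w\<close> is prescribed; on the remaining constant,
        \<open>mu0T w = 0\<close> decides. The factors 1 match \<open>H1T_lincomb\<close>.\<close>
      define \<psi> where "\<psi> = (\<lambda>x. 1 * \<phi> x + (- \<phi> 0) * 1)"
      have "H1T \<psi>" unfolding \<psi>_def by (rule H1T_lincomb[OF True one])
      have "H10 \<psi>" using \<open>H1T \<psi>\<close> True by (simp add: H10_def H1T_def \<psi>_def)
      have "w \<phi> = w (\<lambda>x. \<psi> x + \<phi> 0 * 1)" by (simp add: \<psi>_def)
      also have "\<dots> = w \<psi> + w (\<lambda>x. \<phi> 0 * 1)"
        by (rule w_add[OF \<open>H1T \<psi>\<close>]) (use H1T_lincomb[OF one one, of "\<phi> 0" 0] in simp)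
      also have "w (\<lambda>x. \<phi> 0 * 1) = 0"
        using w_mult[OF one, of "\<phi> 0"] w by (simp add: mu0T_def)
      also have "w \<psi> = div_functional (D1 u) \<psi>"
        using w \<open>H10 \<psi>\<close> \<open>H1T \<psi>\<close> by (simp add: dd_def div_functional_def)
      also have "\<dots> = div_functional (D1 u) \<phi>"
        unfolding \<psi>_def div_functional_lincomb[OF g True one]
        using mu0T_div_functional[OF g] by (simp add: mu0T_def)
      finally show ?thesis by simp
    qed
  qed
qed

section \<open>Almost-everywhere identification of \<open>Pn\<close>\<close>

text \<open>Exhibiting one representative \<open>f\<close> shows that the choice in
  \<open>Pn\<close> succeeds; the chosen function minus \<open>f\<close> is then orthogonal to every
  test function, hence zero almost everywhere.\<close>

lemma Pn_AE:
  assumes f: "L2 f" and rep: "\<And>\<phi>. DT \<phi> \<Longrightarrow> intv 0 1 (\<lambda>x. f x * cnj (\<phi> x)) = w (Jn n \<phi>)"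
  shows "L2 (Pn n w)" and "AE x in lebesgue_on {0..1}. Pn n w x = f x"
proof -
  have "L2 (Pn n w) \<and> (\<forall>\<phi>. DT \<phi> \<longrightarrow> intv 0 1 (\<lambda>x. Pn n w x * cnj (\<phi> x)) = w (Jn n \<phi>))"
    unfolding Pn_def by (rule someI[of _ f]) (use f rep in simp)
  then have P: "L2 (Pn n w)" and Prep: "\<And>\<phi>. DT \<phi> \<Longrightarrow> intv 0 1 (\<lambda>x. Pn n w x * cnj (\<phi> x)) = w (Jn n \<phi>)"
    by auto
  show "L2 (Pn n w)" by (rule P)
  have diff: "L2 (\<lambda>x. Pn n w x + (- 1) * f x)" by (intro L2_add L2_cmult f P)
  have "AE x in lebesgue_on {0..1}. Pn n w x + (- 1) * f x = 0"
  proof (rule AE_zero_of_orthogonal_DT[OF L2_imp_integrable[OF diff]])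
    fix \<phi> assume \<phi>: "DT \<phi>"
    have L2_\<phi>: "L2 \<phi>" using DT_continuous[OF \<phi>] by (rule L2_continuous)
    have "intv 0 1 (\<lambda>x. (Pn n w x + (- 1) * f x) * cnj (\<phi> x))
        = intv 0 1 (\<lambda>x. Pn n w x * cnj (\<phi> x) + (- 1) * (f x * cnj (\<phi> x)))"
      by (simp add: algebra_simps)
    also have "\<dots> = intv 0 1 (\<lambda>x. Pn n w x * cnj (\<phi> x)) + (- 1) * intv 0 1 (\<lambda>x. f x * cnj (\<phi> x))"
      unfolding intv_cmult[symmetric]
      by (intro intv_add integrable_mult_right L2_mult_integrable P f L2_\<phi>)
    also have "\<dots> = 0" using Prep[OF \<phi>] rep[OF \<phi>] by simp
    finally show "intv 0 1 (\<lambda>x. (Pn n w x + (- 1) * f x) * cnj (\<phi> x)) = 0" .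
  qed
  then show "AE x in lebesgue_on {0..1}. Pn n w x = f x" by simp
qed

section \<open>Moments, and functionals evaluated at \<open>Jn n \<phi>\<close>\<close>

text \<open>At \<open>n = 0\<close> natural subtraction gives the exponent 0, and the factor
  \<open>of_nat n\<close> removes the term.\<close>

lemma primitive_power:
  "primitive (\<lambda>x. of_real ((1 - x) ^ n)) (\<lambda>x. - (of_nat n * of_real ((1 - x) ^ (n - 1))))"
proof (rule primitive_deriv)
  fix x :: real
  have "((\<lambda>z. (1 - z) ^ n) has_field_derivative - (of_nat n * (1 - of_real x) ^ (n - 1))) (at (of_real x :: complex))"
    by (auto intro!: derivative_eq_intros)
  then have "((\<lambda>x. (1 - of_real x) ^ n) has_vector_derivative - (of_nat n * (1 - of_real x :: complex) ^ (n - 1)))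
      (at x within {0..1})"
    by (rule has_vector_derivative_real_field)
  then show "((\<lambda>x. of_real ((1 - x) ^ n)) has_vector_derivative - (of_nat n * complex_of_real ((1 - x) ^ (n - 1))))
      (at x within {0..1})"
    by simp
qed (intro continuous_intros)

lemma mu_0: "mu 0 f = intv 0 1 f"
  by (simp add: mu_def)

text \<open>Integration by parts against \<open>(1 - x) ^ n\<close>: \<open>intv 0 x h\<close>
  vanishes at 0 and, as \<open>n \<ge> 1\<close>, the power vanishes at 1, so no boundary term is
  left.\<close>

lemma mu_intv:
  assumes h: "integrable (lebesgue_on {0..1}) h" and n: "n \<ge> 1"
  shows "of_nat n * mu (n - 1) (\<lambda>x. intv 0 x h) = mu n h"
proof -
  have "intv 0 1 (\<lambda>x. h x * of_real ((1 - x) ^ n))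
      + intv 0 1 (\<lambda>x. intv 0 x h * - (of_nat n * of_real ((1 - x) ^ (n - 1)))) = 0"
    using primitive_by_parts[OF primitive_intv[OF h] primitive_power[of n]] n by simp
  moreover have "intv 0 1 (\<lambda>x. h x * of_real ((1 - x) ^ n)) = mu n h"
    by (simp add: mu_def mult.commute)
  moreover have "intv 0 1 (\<lambda>x. intv 0 x h * - (of_nat n * of_real ((1 - x) ^ (n - 1))))
      = (- of_nat n) * mu (n - 1) (\<lambda>x. intv 0 x h)"
    unfolding mu_def by (subst intv_cmult[symmetric], rule intv_cong) (simp add: mult_ac)
  ultimately show ?thesis by simp
qed

text \<open>The same integration by parts with \<open>u\<close>; the boundary term at 0, where the
  power equals 1, survives.\<close>

lemma mu_D1:
  assumes u: "H1 u" and n: "n \<ge> 1"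
  shows "mu n (D1 u) = of_nat n * mu (n - 1) u - u 0"
proof -
  have "intv 0 1 (\<lambda>x. D1 u x * of_real ((1 - x) ^ n))
      + intv 0 1 (\<lambda>x. u x * - (of_nat n * of_real ((1 - x) ^ (n - 1)))) = - u 0"
    using primitive_by_parts[OF primitive_D1[OF u] primitive_power[of n]] n by simp
  moreover have "intv 0 1 (\<lambda>x. D1 u x * of_real ((1 - x) ^ n)) = mu n (D1 u)"
    by (simp add: mu_def mult.commute)
  moreover have "intv 0 1 (\<lambda>x. u x * - (of_nat n * of_real ((1 - x) ^ (n - 1))))
      = (- of_nat n) * mu (n - 1) u"
    unfolding mu_def by (subst intv_cmult[symmetric], rule intv_cong) (simp add: mult_ac)
  ultimately show ?thesis by (simp add: algebra_simps)
qed

lemma primitive_cong: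
  assumes "primitive F f" "\<And>x. x \<in> {0..1} \<Longrightarrow> G x = F x"
  shows "primitive G f"
  using assms by (simp add: primitive_def)

text \<open>The subtracted multiple of \<open>(1 - x) ^ n\<close> cancels the value
  \<open>mu 0 \<phi>\<close> of the integral at 0 and, as \<open>n \<ge> 1\<close>, vanishes at 1.
  Thus \<open>Jn n \<phi>\<close> lies in \<open>H1T\<close> and integrations by parts against it
  have no boundary terms.\<close>

lemma
  assumes \<phi>: "continuous_on {0..1} \<phi>" and n: "n \<ge> 1"
  shows weak_deriv_Jn: "weak_deriv (Jn n \<phi>)
      (\<lambda>x. (- 1) * \<phi> x + (of_nat n * mu 0 \<phi>) * of_real ((1 - x) ^ (n - 1)))" (is "weak_deriv _ ?d")
    and Jn_0: "Jn n \<phi> 0 = 0" and Jn_1: "Jn n \<phi> 1 = 0"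
proof -
  have int: "integrable (lebesgue_on {0..1}) \<phi>" using \<phi> by (rule continuous_imp_integrable_real)
  have J: "Jn n \<phi> x = mu 0 \<phi> - intv 0 x \<phi> - mu 0 \<phi> * of_real ((1 - x) ^ n)" if "x \<in> {0..1}" for x
  proof -
    have "intv 0 1 \<phi> = intv 0 x \<phi> + intv x 1 \<phi>"
      unfolding intv_def using that by (intro integral_combine[OF int]) auto
    then show ?thesis by (simp add: Jn_def mu_0)
  qed
  show "Jn n \<phi> 0 = 0" "Jn n \<phi> 1 = 0" using n by (simp_all add: J mu_0)
  \<comment> \<open>The padded coefficients give the nested form to which
    \<open>primitive_lincomb\<close> applies twice.\<close>
  have "primitive (\<lambda>x. 1 * (1 * mu 0 \<phi> + (- 1) * intv 0 x \<phi>) + (- mu 0 \<phi>) * of_real ((1 - x) ^ n))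
      (\<lambda>x. 1 * (1 * 0 + (- 1) * \<phi> x) + (- mu 0 \<phi>) * - (of_nat n * of_real ((1 - x) ^ (n - 1))))"
    using weak_deriv_const[of "mu 0 \<phi>"] unfolding weak_deriv_iff_primitive
    by (intro primitive_lincomb primitive_power primitive_intv[OF int]) auto
  then have "primitive (\<lambda>x. mu 0 \<phi> - intv 0 x \<phi> - mu 0 \<phi> * of_real ((1 - x) ^ n)) ?d"
    by (simp add: algebra_simps)
  then have "primitive (Jn n \<phi>) ?d" by (rule primitive_cong) (rule J)
  moreover have "L2 ?d"
    using \<phi> by (intro L2_continuous continuous_intros)
  ultimately show "weak_deriv (Jn n \<phi>) ?d" by (simp add: weak_deriv_iff_primitive)
qed

lemma intv_mult_cnj_const: "intv 0 1 (\<lambda>x. c * cnj (\<phi> x)) = c * cnj (mu 0 \<phi>)"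
  by (simp add: intv_cmult intv_cnj mu_0)

text \<open>Supplies the representative of \<open>Pn n (div_functional g)\<close>. The derivative of
  \<open>Jn n \<phi>\<close> is \<open>- \<phi>\<close> plus a multiple of
  \<open>(1 - x) ^ (n - 1)\<close>, and pairing \<open>g\<close> with that power produces the
  constant.\<close>

lemma div_functional_Jn:
  assumes g: "L2 g" and \<phi>: "DT \<phi>" and n: "n \<ge> 1"
  shows "intv 0 1 (\<lambda>x. (g x - of_nat n * mu (n - 1) g) * cnj (\<phi> x)) = div_functional g (Jn n \<phi>)"
proof -
  define q where "q = (\<lambda>x. complex_of_real ((1 - x) ^ (n - 1)))"
  have cont: "continuous_on {0..1} \<phi>" using \<phi> by (rule DT_continuous)
  have L2: "L2 \<phi>" "L2 q" using cont by (auto simp: q_def intro!: L2_continuous continuous_intros)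
  have "div_functional g (Jn n \<phi>) = - intv 0 1 (\<lambda>x. g x * cnj ((- 1) * \<phi> x + (of_nat n * mu 0 \<phi>) * q x))"
    unfolding q_def using weak_deriv_Jn[OF cont n] Jn_0[OF cont n] Jn_1[OF cont n]
    by (intro div_functional_eq[OF g]) auto
  also have "\<dots> = intv 0 1 (\<lambda>x. g x * cnj (\<phi> x)) - of_nat n * cnj (mu 0 \<phi>) * intv 0 1 (\<lambda>x. g x * cnj (q x))"
    unfolding intv_mult_cnj_lincomb[OF g L2] by simp
  also have "intv 0 1 (\<lambda>x. g x * cnj (q x)) = mu (n - 1) g"
    by (simp add: mu_def q_def mult.commute)
  also have "intv 0 1 (\<lambda>x. g x * cnj (\<phi> x)) - of_nat n * cnj (mu 0 \<phi>) * mu (n - 1) g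
      = intv 0 1 (\<lambda>x. g x * cnj (\<phi> x)) + intv 0 1 (\<lambda>x. - (of_nat n * mu (n - 1) g) * cnj (\<phi> x))"
    unfolding intv_mult_cnj_const by (simp add: mult_ac)
  also have "\<dots> = intv 0 1 (\<lambda>x. g x * cnj (\<phi> x) + - (of_nat n * mu (n - 1) g) * cnj (\<phi> x))"
    by (intro intv_add[symmetric] L2_mult_integrable g L2_const L2)
  finally show ?thesis by (simp add: algebra_simps)
qed

text \<open>Supplies the representative of \<open>Pn n (embT h)\<close>. Integration by parts trades
  \<open>h\<close> for its primitive and \<open>Jn n \<phi>\<close> for its derivative; the power in
  that derivative yields \<open>mu n h\<close> through \<open>mu_intv\<close>.\<close>

lemma embT_Jn:
  assumes h: "L2 h" and \<phi>: "DT \<phi>" and n: "n \<ge> 1"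
  shows "intv 0 1 (\<lambda>x. (intv 0 x h - mu n h) * cnj (\<phi> x)) = embT h (Jn n \<phi>)"
proof -
  define q where "q = (\<lambda>x. complex_of_real ((1 - x) ^ (n - 1)))"
  define H where "H = (\<lambda>x. intv 0 x h)"
  have hi: "integrable (lebesgue_on {0..1}) h" using h by (rule L2_imp_integrable)
  have H: "primitive H h" unfolding H_def by (rule primitive_intv[OF hi])
  have cont: "continuous_on {0..1} \<phi>" using \<phi> by (rule DT_continuous)
  have L2: "L2 \<phi>" "L2 q" "L2 H"
    using cont primitive_continuous[OF H] by (auto simp: q_def intro!: L2_continuous continuous_intros)
  have wd: "weak_deriv (Jn n \<phi>) (\<lambda>x. (- 1) * \<phi> x + (of_nat n * mu 0 \<phi>) * q x)"
    unfolding q_def by (rule weak_deriv_Jn[OF cont n])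
  then have J: "primitive (Jn n \<phi>) (\<lambda>x. (- 1) * \<phi> x + (of_nat n * mu 0 \<phi>) * q x)"
    by (simp add: weak_deriv_iff_primitive)
  have "H1T (Jn n \<phi>)"
    using weak_deriv_imp_H1[OF wd] Jn_0[OF cont n] Jn_1[OF cont n] by (simp add: H1T_def)
  then have "embT h (Jn n \<phi>) = intv 0 1 (\<lambda>x. h x * cnj (Jn n \<phi> x))"
    by (simp add: embT_def)
  also have "\<dots> = - intv 0 1 (\<lambda>x. H x * cnj ((- 1) * \<phi> x + (of_nat n * mu 0 \<phi>) * q x))"
    using primitive_by_parts[OF H primitive_cnj[OF J]] Jn_0[OF cont n] Jn_1[OF cont n]
    by (simp add: add_eq_0_iff2)
  also have "\<dots> = intv 0 1 (\<lambda>x. H x * cnj (\<phi> x)) - of_nat n * cnj (mu 0 \<phi>) * intv 0 1 (\<lambda>x. H x * cnj (q x))"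
    unfolding intv_mult_cnj_lincomb[OF L2(3) L2(1,2)] by simp
  also have "intv 0 1 (\<lambda>x. H x * cnj (q x)) = mu (n - 1) H"
    by (simp add: mu_def q_def mult.commute)
  also have "of_nat n * cnj (mu 0 \<phi>) * mu (n - 1) H = mu n h * cnj (mu 0 \<phi>)"
    using mu_intv[OF hi n] by (simp add: H_def mult_ac)
  also have "intv 0 1 (\<lambda>x. H x * cnj (\<phi> x)) - mu n h * cnj (mu 0 \<phi>)
      = intv 0 1 (\<lambda>x. H x * cnj (\<phi> x)) + intv 0 1 (\<lambda>x. - mu n h * cnj (\<phi> x))"
    unfolding intv_mult_cnj_const by simp
  also have "\<dots> = intv 0 1 (\<lambda>x. H x * cnj (\<phi> x) + - mu n h * cnj (\<phi> x))"
    by (intro intv_add[symmetric] L2_mult_integrable L2_const L2)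
  finally show ?thesis by (simp add: H_def algebra_simps)
qed

section \<open>Evaluation of the inner product\<close>

theorem mainTheorem3:
  fixes n :: nat and u h :: "real \<Rightarrow> complex"
  assumes "n \<ge> 2" and "H1 u" and "L2 h"
  shows "innerT n (Idm_inv (dd u)) (embT h) =
     - intv 0 1 (\<lambda>x. u x * cnj (h x))
     + u 1 * cnj (mu 0 h)
     + (of_nat n * u 0 - of_nat (n * (n - 1)) * mu (n - 2) u) * cnj (mu 1 h)
     + ((1 - of_nat n) * u 0 - u 1 + of_nat (n * (n - 1)) * mu (n - 2) u) * cnj (mu n h)"
proof -
  note u = \<open>H1 u\<close> and h = \<open>L2 h\<close>
  have n: "n \<ge> 1" "n - 1 \<ge> 1" using assms(1) by auto
  note g = L2_D1[OF u]
  \<comment> \<open>The constant in the representative of the first argument, with the moment of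
    \<open>D1 u\<close> rewritten by \<open>mu_D1\<close> in terms of \<open>u\<close>; this uses
    \<open>n - 1 \<ge> 1\<close>.\<close>
  define A where "A = of_nat n * u 0 - of_nat (n * (n - 1)) * mu (n - 2) u"
  have A: "- (of_nat n * mu (n - 1) (D1 u)) = A"
    unfolding mu_D1[OF u n(2)] A_def using assms(1)
    by (simp add: algebra_simps numeral_2_eq_2)
  define H where "H = (\<lambda>x. intv 0 x h)"
  have hi: "integrable (lebesgue_on {0..1}) h" using h by (rule L2_imp_integrable)
  have H: "primitive H h" unfolding H_def by (rule primitive_intv[OF hi])
  have L2_H: "L2 H" by (rule L2_continuous[OF primitive_continuous[OF H]])
  have F: "L2 (\<lambda>x. D1 u x + A)" by (intro L2_add g L2_const)
  have G: "L2 (\<lambda>x. 1 * H x + (- 1) * mu n h)" by (intro L2_add L2_cmult L2_H L2_const)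
  have repF: "intv 0 1 (\<lambda>x. (D1 u x + A) * cnj (\<phi> x)) = div_functional (D1 u) (Jn n \<phi>)" if "DT \<phi>" for \<phi>
    using div_functional_Jn[OF g that n(1)] unfolding A[symmetric] by simp
  have repG: "intv 0 1 (\<lambda>x. (1 * H x + (- 1) * mu n h) * cnj (\<phi> x)) = embT h (Jn n \<phi>)" if "DT \<phi>" for \<phi>
    using embT_Jn[OF h that n(1)] by (simp add: H_def)
  have PF: "L2 (Pn n (div_functional (D1 u)))"
      "AE x in lebesgue_on {0..1}. Pn n (div_functional (D1 u)) x = D1 u x + A"
    using Pn_AE[OF F] repF by blast+
  have PG: "L2 (Pn n (embT h))"
      "AE x in lebesgue_on {0..1}. Pn n (embT h) x = 1 * H x + (- 1) * mu n h"
    using Pn_AE[OF G] repG by blast+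
  \<comment> \<open>The product of the means drops out because the first argument has mean
    zero.\<close>
  have "innerT n (Idm_inv (dd u)) (embT h)
      = intv 0 1 (\<lambda>x. Pn n (div_functional (D1 u)) x * cnj (Pn n (embT h) x))"
    by (simp add: innerT_def Idm_inv_dd[OF u] mu0T_div_functional[OF g])
  also have "\<dots> = intv 0 1 (\<lambda>x. (D1 u x + A) * cnj (1 * H x + (- 1) * mu n h))"
  proof (rule intv_cong_AE)
    show "AE x in lebesgue_on {0..1}. Pn n (div_functional (D1 u)) x * cnj (Pn n (embT h) x)
        = (D1 u x + A) * cnj (1 * H x + (- 1) * mu n h)"
      using PF(2) PG(2) by eventually_elim simp
  qed (intro L2_mult_integrable F G PF(1) PG(1))+
  also have "\<dots> = intv 0 1 (\<lambda>x. (D1 u x + A) * cnj (H x)) - cnj (mu n h) * intv 0 1 (\<lambda>x. D1 u x + A)"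
    using intv_mult_cnj_lincomb[OF F L2_H L2_const[of 1], where a = 1 and b = "- mu n h"] by simp
  also have "intv 0 1 (\<lambda>x. (D1 u x + A) * cnj (H x)) = intv 0 1 (\<lambda>x. D1 u x * cnj (H x)) + A * cnj (mu 0 H)"
    unfolding distrib_right intv_mult_cnj_const[symmetric]
    by (intro intv_add L2_mult_integrable g L2_H L2_const)
  also have "mu 0 H = mu 1 h"
    using mu_intv[OF hi, of 1] by (simp add: H_def)
  \<comment> \<open>Integration by parts with \<open>H 0 = 0\<close> and
    \<open>H 1 = mu 0 h\<close>.\<close>
  also have "intv 0 1 (\<lambda>x. D1 u x * cnj (H x)) = u 1 * cnj (mu 0 h) - intv 0 1 (\<lambda>x. u x * cnj (h x))"
    using primitive_by_parts[OF primitive_D1[OF u] primitive_cnj[OF H]]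
    by (simp add: H_def mu_0 eq_diff_eq)
  \<comment> \<open>With a minus sign, this is the coefficient of \<open>cnj (mu n h)\<close> in the
    result.\<close>
  also have "intv 0 1 (\<lambda>x. D1 u x + A) = u 1 - u 0 + A"
  proof -
    have "intv 0 1 (\<lambda>x. D1 u x + A) = intv 0 1 (D1 u) + intv 0 1 (\<lambda>x. A)"
      by (intro intv_add L2_imp_integrable g L2_const)
    also have "intv 0 1 (D1 u) = u 1 - u 0"
      using primitive_D1[OF u] by (simp add: primitive_def)
    also have "intv 0 1 (\<lambda>x. A) = A"
      by (simp add: intv_def measure_restrict_space)
    finally show ?thesis .
  qed
  finally show ?thesis unfolding A_def by (simp add: algebra_simps)
qed

end
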